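(* Let $3\leq n\leq 5$, let $I_n=\{0,\ldots,n-1\}$, and let $\mathrm{U}_n\subseteq\{0,1\}^n$ be the set of binary sequences of length $n$ containing exactly one occurrence of $1$. For $a\in I_n$, let $K_a$ be the simplicial complex over $I_n$ whose maximal simplices are the sets $\{a,b,c\}$ with $b,c$ distinct elements of $I_n\setminus\{a\}$. Then the only minimal complexes generating $\mathrm{U}_n$ are those of the form $K_a$, $a\in I_n$.
   Context: All sets are finite (possibly empty). For $f:B^J\to A^I$ write $f_i(x)=f(x)_i$. For $i\in I$, the input window $\mathcal{W}_f(i)$ is the smallest set $W\subseteq J$ (it exists) such that for all $x,y\in B^J$, $x|_W=y|_W$ implies $f_i(x)=f_i(y)$. A simplicial complex (or complex) over $I$ is a collection of subsets of $I$ (its simplices) closed under taking subsets; the empty set is a simplex of every complex. The communication complex $K_f$ of $f$ is the complex over $I$ in which a non-empty $S\subseteq I$ is a simplex iff $\bigcap_{i\in S}\mathcal{W}_f(i)\neq\emptyset$. A complex $K$ over $I$ generates a language $L\subseteq A^I$ if there exist finite sets $B,J$ and a function $f:B^J\to A^I$ with image exactly $L$ and $K_f\subseteq K$. A complex generating $L$ is minimal if no complex strictly contained in it generates $L$. We write $\{0,1\}^n$ for $\{0,1\}^{I_n}$. *)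

theory Defs
  imports "HOL-Library.FuncSet"
begin

text \<open>
  The power \<open>X\<^sup>Y\<close> of sets is the extensional function space \<open>Y \<rightarrow>\<^sub>E X\<close>, so that the
  restriction \<open>x|\<^sub>W\<close> is \<^term>\<open>restrict x W\<close>.
\<close>

definition simplicial_complex :: "'i set \<Rightarrow> 'i set set \<Rightarrow> bool" where
  "simplicial_complex I K \<longleftrightarrow>
     K \<subseteq> Pow I \<and> {} \<in> K \<and> (\<forall>S\<in>K. \<forall>T. T \<subseteq> S \<longrightarrow> T \<in> K)"

definition maximal_simplices :: "'i set set \<Rightarrow> 'i set set" where
  "maximal_simplices K = {S \<in> K. \<forall>T\<in>K. S \<subseteq> T \<longrightarrow> S = T}"

definition determines ::
  "'j set \<Rightarrow> 'b set \<Rightarrow> (('j \<Rightarrow> 'b) \<Rightarrow> 'i \<Rightarrow> 'a) \<Rightarrow> 'i \<Rightarrow> 'j set \<Rightarrow> bool" where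
  "determines J B f i W \<longleftrightarrow>
     (\<forall>x \<in> J \<rightarrow>\<^sub>E B. \<forall>y \<in> J \<rightarrow>\<^sub>E B. restrict x W = restrict y W \<longrightarrow> f x i = f y i)"

text \<open>\<open>LEAST\<close> is with respect to inclusion; the least set exists for finite \<open>J\<close>, as shown
  in \<open>input_window_least\<close> below.\<close>

definition input_window ::
  "'j set \<Rightarrow> 'b set \<Rightarrow> (('j \<Rightarrow> 'b) \<Rightarrow> 'i \<Rightarrow> 'a) \<Rightarrow> 'i \<Rightarrow> 'j set" where
  "input_window J B f i = (LEAST W. W \<subseteq> J \<and> determines J B f i W)"

definition communication_complex ::
  "'j set \<Rightarrow> 'b set \<Rightarrow> 'i set \<Rightarrow> (('j \<Rightarrow> 'b) \<Rightarrow> 'i \<Rightarrow> 'a) \<Rightarrow> 'i set set" where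
  "communication_complex J B I f =
     {S. S \<subseteq> I \<and> (S \<noteq> {} \<longrightarrow> (\<Inter>i\<in>S. input_window J B f i) \<noteq> {})}"

text \<open>The finite sets \<open>B\<close> and \<open>J\<close> are taken among the finite sets of natural numbers. Since
  the condition depends on \<open>B\<close> and \<open>J\<close> only up to bijection, this is no restriction.\<close>

definition generates :: "'i set \<Rightarrow> 'a set \<Rightarrow> 'i set set \<Rightarrow> ('i \<Rightarrow> 'a) set \<Rightarrow> bool" where
  "generates I A K L \<longleftrightarrow>
     simplicial_complex I K \<and>
     (\<exists>(B :: nat set) (J :: nat set) f.
        finite B \<and> finite J \<and>
        f \<in> (J \<rightarrow>\<^sub>E B) \<rightarrow> (I \<rightarrow>\<^sub>E A) \<and>
        f ` (J \<rightarrow>\<^sub>E B) = L \<and>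
        communication_complex J B I f \<subseteq> K)"

definition minimal_generating :: "'i set \<Rightarrow> 'a set \<Rightarrow> 'i set set \<Rightarrow> ('i \<Rightarrow> 'a) set \<Rightarrow> bool" where
  "minimal_generating I A K L \<longleftrightarrow>
     generates I A K L \<and> \<not> (\<exists>K'. K' \<subset> K \<and> generates I A K' L)"

definition index_set :: "nat \<Rightarrow> nat set" where
  "index_set n = {0..<n}"

definition unique_one :: "nat \<Rightarrow> (nat \<Rightarrow> nat) set" where
  "unique_one n = {x \<in> index_set n \<rightarrow>\<^sub>E {0, 1}. \<exists>!i. i \<in> index_set n \<and> x i = 1}"

definition star_triangles :: "nat \<Rightarrow> nat \<Rightarrow> nat set set" where
  "star_triangles n a = {{a, b, c} | b c. b \<in> index_set n - {a} \<and> c \<in> index_set n - {a} \<and> b \<noteq> c}"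

text \<open>The complex with the sets \<open>{a, b, c}\<close> as maximal simplices is their downward closure;
  see \<open>star_complex_iff\<close> below.\<close>

definition star_complex :: "nat \<Rightarrow> nat \<Rightarrow> nat set set" where
  "star_complex n a = {S. \<exists>T \<in> star_triangles n a. S \<subseteq> T}"

lemma determines_Int:
  assumes U: "determines J B f i U" and V: "determines J B f i V"
  shows "determines J B f i (U \<inter> V)"
  unfolding determines_def
proof (intro ballI impI)
  fix x y assume x: "x \<in> J \<rightarrow>\<^sub>E B" and y: "y \<in> J \<rightarrow>\<^sub>E B"
    and eq: "restrict x (U \<inter> V) = restrict y (U \<inter> V)"
  define z where "z = (\<lambda>j. if j \<in> U then x j else y j)"
  have z: "z \<in> J \<rightarrow>\<^sub>E B"
    using x y by (auto simp: z_def PiE_iff extensional_def)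
  have xy: "x j = y j" if "j \<in> U" "j \<in> V" for j
    using fun_cong[OF eq, of j] that by simp
  have "restrict x U = restrict z U" "restrict z V = restrict y V"
    using xy by (auto simp: z_def restrict_def)
  then show "f x i = f y i"
    using U V x y z unfolding determines_def by metis
qed

lemma input_window_least:
  assumes "finite J"
  shows "input_window J B f i \<subseteq> J" "determines J B f i (input_window J B f i)"
    and "\<And>W. W \<subseteq> J \<Longrightarrow> determines J B f i W \<Longrightarrow> input_window J B f i \<subseteq> W"
proof -
  let ?P = "\<lambda>W. W \<subseteq> J \<and> determines J B f i W"
  have "?P J"
    unfolding determines_def by (auto simp: PiE_restrict)
  then have "\<exists>W. ?P W \<and> (\<forall>V. ?P V \<longrightarrow> card W \<le> card V)"
    using ex_has_least_nat[of ?P J card] by blast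
  then obtain W where W: "?P W" and min: "\<And>V. ?P V \<Longrightarrow> card W \<le> card V"
    by blast
  have least: "W \<subseteq> V" if "?P V" for V
  proof -
    have "card W \<le> card (W \<inter> V)"
      using W that by (intro min conjI determines_Int) auto
    moreover have "finite W"
      using W assms finite_subset by blast
    ultimately have "W \<inter> V = W"
      by (intro card_seteq) auto
    then show ?thesis by blast
  qed
  have "input_window J B f i = W"
    unfolding input_window_def using W least by (intro Least_equality) auto
  then show "input_window J B f i \<subseteq> J" "determines J B f i (input_window J B f i)"
    "\<And>W. W \<subseteq> J \<Longrightarrow> determines J B f i W \<Longrightarrow> input_window J B f i \<subseteq> W"
    using W least by auto
qed

lemma star_complex_iff:
  assumes n: "3 \<le> n" and a: "a \<in> index_set n"
  shows "simplicial_complex (index_set n) K \<and> maximal_simplices K = star_triangles n a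
    \<longleftrightarrow> K = star_complex n a"
proof
  assume K: "simplicial_complex (index_set n) K \<and> maximal_simplices K = star_triangles n a"
  then have fin: "finite K"
    by (metis finite_Pow_iff finite_atLeastLessThan finite_subset index_set_def
        simplicial_complex_def)
  have "\<exists>T \<in> maximal_simplices K. S \<subseteq> T" if "S \<in> K" for S
    using finite_has_maximal2[OF fin that] unfolding maximal_simplices_def by blast
  then have "K \<subseteq> star_complex n a"
    using K by (auto simp: star_complex_def)
  moreover have "star_complex n a \<subseteq> K"
  proof
    fix S assume "S \<in> star_complex n a"
    then obtain T where "T \<in> maximal_simplices K" "S \<subseteq> T"
      using K by (auto simp: star_complex_def)
    then show "S \<in> K"
      using K by (simp add: maximal_simplices_def simplicial_complex_def) blast
  qed
  ultimately show "K = star_complex n a" ..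
next
  assume K: "K = star_complex n a"
  have "card (index_set n - {a}) \<ge> 2"
    using n a by (simp add: index_set_def)
  then obtain D where "D \<subseteq> index_set n - {a}" "card D = 2"
    by (rule obtain_subset_with_card_n)
  then obtain b c where bc: "b \<in> index_set n - {a}" "c \<in> index_set n - {a}" "b \<noteq> c"
    unfolding card_2_iff by blast
  have "{a, b, c} \<in> star_triangles n a"
    using bc unfolding star_triangles_def by blast
  moreover have "T \<subseteq> index_set n" if "T \<in> star_triangles n a" for T
    using that a by (auto simp: star_triangles_def)
  ultimately have "simplicial_complex (index_set n) K"
    unfolding K simplicial_complex_def star_complex_def by (blast intro: order_trans)
  moreover have "maximal_simplices K = star_triangles n a"
  proof -
    have card3: "card T = 3" if "T \<in> star_triangles n a" for T
      using that by (auto simp: star_triangles_def)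
    have antichain: "S = T" if "S \<in> star_triangles n a" "T \<in> star_triangles n a" "S \<subseteq> T" for S T
    proof (rule card_subset_eq)
      show "finite T"
        using card3[OF that(2)] by (intro card_ge_0_finite) simp
    qed (use that card3 in auto)
    show ?thesis
      unfolding K
    proof (intro equalityI subsetI)
      fix S assume S: "S \<in> maximal_simplices (star_complex n a)"
      then obtain T where T: "T \<in> star_triangles n a" "S \<subseteq> T"
        by (auto simp: maximal_simplices_def star_complex_def)
      then have "T \<in> star_complex n a"
        by (auto simp: star_complex_def)
      with S T show "S \<in> star_triangles n a"
        by (auto simp: maximal_simplices_def)
    next
      fix S assume S: "S \<in> star_triangles n a"
      have "S = T" if T: "T \<in> star_complex n a" "S \<subseteq> T" for T
      proof -
        obtain U where U: "U \<in> star_triangles n a" "T \<subseteq> U"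
          using T by (auto simp: star_complex_def)
        with S T(2) have "S = U"
          by (intro antichain) auto
        with U T show ?thesis by auto
      qed
      with S show "S \<in> maximal_simplices (star_complex n a)"
        by (auto simp: maximal_simplices_def star_complex_def)
    qed
  qed
  ultimately show "simplicial_complex (index_set n) K \<and> maximal_simplices K = star_triangles n a"
    by blast
qed

end

theory Submission imports Defs "HOL-Library.Nat_Bijection" begin

text \<open>
  A function onto \<open>U\<^sub>n\<close> names a winner in \<open>I\<^sub>n\<close>, and output \<open>i\<close> only has to know
  whether \<open>i\<close> wins.

  \<open>K\<^sub>a\<close> generates \<open>U\<^sub>n\<close>: every pair \<open>{b, c}\<close> avoiding \<open>a\<close> carries an input, read by
  \<open>a\<close>, \<open>b\<close> and \<open>c\<close>, which votes for an element of \<open>I\<^sub>n\<close>; \<open>b\<close> wins if it gets the votes of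
  all its pairs, and \<open>a\<close> wins if nobody else does.

  Conversely, if a generating complex contains no \<open>K\<^sub>a\<close>, then every vertex lies in a triangle
  missing from it. For \<open>n \<le> 5\<close>, such a cover contains either all triangles over some fixed
  pair \<open>{i, j}\<close>, or two triangles sharing a single vertex \<open>c\<close>. Both are impossible: for
  fixed values of the inputs not read by \<open>c\<close> (or, for a pair, not read by the outputs other
  than \<open>i\<close> and \<open>j\<close>), two outputs in a missing triangle with it depend on disjoint sets of
  inputs, and since they are never 1 together, one of them vanishes.
\<close>

section \<open>A Boolean function covered by a cycle of four binary functions\<close>

text \<open>Two opposite functions in the cycle \<open>f, g, h, k\<close> have no common variable, so for each
  \<open>u\<close> one of them vanishes. Choosing \<open>u\<close> where a given function does not vanish shows that
  \<open>Z\<close> ignores one of the two variables not occurring in it.\<close>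

lemma cyclic_cover_constant:
  fixes f g h k :: "'u \<Rightarrow> 'x \<Rightarrow> 'x \<Rightarrow> bool" and Z :: "'x \<Rightarrow> 'x \<Rightarrow> 'x \<Rightarrow> 'x \<Rightarrow> bool"
  assumes Z: "\<And>u a b c d. Z a b c d \<longleftrightarrow> f u a b \<or> g u b c \<or> h u c d \<or> k u d a"
    and fh: "\<And>u a b c d. \<not> (f u a b \<and> h u c d)"
    and gk: "\<And>u a b c d. \<not> (g u b c \<and> k u d a)"
    and fk: "\<And>u a b d. \<not> (f u a b \<and> k u d a)"
    and fg: "\<And>u a b c. \<not> (f u a b \<and> g u b c)"
    and ex: "f uf af bf" "g ug bg cg" "h uh ch dh" "k uk dk ak"
  shows "Z a b c d"
proof (rule ccontr)
  assume nZ: "\<not> Z a b c d"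
  have f: "Z af bf c d" and h: "Z a b ch dh" for a b c d
    using Z ex by blast+
  define indA where "indA \<longleftrightarrow> (\<forall>a a' b c d. Z a b c d = Z a' b c d)"
  define indB where "indB \<longleftrightarrow> (\<forall>a b b' c d. Z a b c d = Z a b' c d)"
  define indC where "indC \<longleftrightarrow> (\<forall>a b c c' d. Z a b c d = Z a b c' d)"
  define indD where "indD \<longleftrightarrow> (\<forall>a b c d d'. Z a b c d = Z a b c d')"
  have at_f: "(\<forall>a b c d. Z a b c d = (f uf a b \<or> g uf b c)) \<or> (\<forall>a b c d. Z a b c d = (f uf a b \<or> k uf d a))"
    using Z[of _ _ _ _ uf] fh[of uf] gk[of uf] ex(1) by metis
  have at_g: "(\<forall>a b c d. Z a b c d = (f ug a b \<or> g ug b c)) \<or> (\<forall>a b c d. Z a b c d = (g ug b c \<or> h ug c d))"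
    using Z[of _ _ _ _ ug] fh[of ug] gk[of ug] ex(2) by metis
  have at_h: "(\<forall>a b c d. Z a b c d = (h uh c d \<or> g uh b c)) \<or> (\<forall>a b c d. Z a b c d = (h uh c d \<or> k uh d a))"
    using Z[of _ _ _ _ uh] fh[of uh] gk[of uh] ex(3) by metis
  have at_k: "(\<forall>a b c d. Z a b c d = (f uk a b \<or> k uk d a)) \<or> (\<forall>a b c d. Z a b c d = (h uk c d \<or> k uk d a))"
    using Z[of _ _ _ _ uk] fh[of uk] gk[of uk] ex(4) by metis
  have "indC \<or> indD" using at_f unfolding indC_def indD_def by metis
  moreover have "indA \<or> indD" using at_g unfolding indA_def indD_def by metis
  moreover have "indA \<or> indB" using at_h unfolding indA_def indB_def by metis
  moreover have "indB \<or> indC" using at_k unfolding indB_def indC_def by metis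
  \<comment> \<open>The four disjunctions are the edges of a 4-cycle on the variables, and a vertex
    cover of a 4-cycle contains two opposite vertices.\<close>
  ultimately consider "indA" "indC" | "indB" "indD" by blast
  then show False
  proof cases
    case 1
    then have Zb: "Z a bf c d" and Zd: "Z a b c dh" for a b c d
      using f h unfolding indA_def indC_def by blast+
    from at_f show False
    proof
      assume *: "\<forall>a b c d. Z a b c d = (f uf a b \<or> g uf b c)"
      then show False using Zd nZ by blast
    next
      assume *: "\<forall>a b c d. Z a b c d = (f uf a b \<or> k uf d a)"
      then have "\<not> f uf a b" "\<not> k uf d a" using nZ by blast+
      \<comment> \<open>From the point where \<open>Z\<close> fails, changing only \<open>b\<close>
        to \<open>bf\<close> or only \<open>d\<close> to \<open>dh\<close> makes \<open>Z\<close>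
        true. The first change is invisible to \<open>k\<close>, the second to \<open>f\<close>, so
        \<open>f\<close> and \<open>k\<close> become true with the same \<open>a\<close>.\<close>
      then have "f uf a bf" "k uf dh a" using Zb[of a c d] Zd[of a b c] * by blast+
      then show False using fk by blast
    qed
  next
    case 2
    then have Za: "Z af b c d" and Zc: "Z a b ch d" for a b c d
      using f h unfolding indB_def indD_def by blast+
    from at_f show False
    proof
      assume *: "\<forall>a b c d. Z a b c d = (f uf a b \<or> g uf b c)"
      then have "\<not> f uf a b" "\<not> g uf b c" using nZ by blast+
      then have "f uf af b" "g uf b ch" using Za[of b c d] Zc[of a b d] * by blast+
      then show False using fg by blast
    next
      assume *: "\<forall>a b c d. Z a b c d = (f uf a b \<or> k uf d a)"
      then show False using Zc nZ by blast
    qed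
  qed
qed

section \<open>Functions naming a winner, and missing triples\<close>

text \<open>Inputs range over all functions, so that gluing several of them needs no domain
  condition.\<close>

locale winner =
  fixes I :: "'i set" and W :: "'i \<Rightarrow> 'j set" and w :: "('j \<Rightarrow> 'b) \<Rightarrow> 'i"
  assumes range_w: "range w = I"
    and window: "\<And>i x y. i \<in> I \<Longrightarrow> (\<And>j. j \<in> W i \<Longrightarrow> x j = y j) \<Longrightarrow> w x = i \<Longrightarrow> w y = i"
begin

lemma w_in: "w x \<in> I"
  using range_w by blast

text \<open>On the inputs \<open>R\<close> read by the other outputs, \<open>W i\<close> and
  \<open>W j\<close> are disjoint. Hence at \<open>glue u s t\<close>, whether \<open>i\<close> wins
  ignores \<open>t\<close>, whether \<open>j\<close> wins ignores \<open>s\<close>, and any other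
  winner ignores \<open>u\<close>.\<close>

lemma no_disconnected_pair:
  assumes ij: "i \<in> I" "j \<in> I" "i \<noteq> j" and k: "k \<in> I - {i, j}"
    and disj: "\<And>l. l \<in> I - {i, j} \<Longrightarrow> W i \<inter> W j \<inter> W l = {}"
  shows False
proof -
  define R where "R = (\<Union>l\<in>I - {i, j}. W l)"
  define glue where "glue u s t = (\<lambda>m. if m \<in> R then if m \<in> W j then t m else s m else u m)"
    for u s t :: "'j \<Rightarrow> 'b"
  have R: "w x \<notin> {i, j} \<Longrightarrow> (\<And>m. m \<in> R \<Longrightarrow> x m = y m) \<Longrightarrow> w y = w x" for x y
    using window[of "w x" x y] w_in[of x] by (auto simp: R_def)
  have i: "w (glue u s t) = i \<Longrightarrow> w (glue u s t') = i" for u s t t'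
    by (rule window[of i "glue u s t"]) (use ij disj in \<open>auto simp: glue_def R_def\<close>)
  have j: "w (glue u s t) = j \<Longrightarrow> w (glue u s' t) = j" for u s s' t
    by (rule window[of j "glue u s t"]) (use ij in \<open>auto simp: glue_def R_def\<close>)
  have Z: "w (glue u s t) \<notin> {i, j} \<Longrightarrow> w (glue u' s t) = w (glue u s t)" for u u' s t
    by (rule R) (auto simp: glue_def)
  have diag: "glue x x x = x" for x
    by (auto simp: glue_def)
  obtain x y z where xyz: "w x = i" "w y = j" "w z = k"
    using range_w ij k by (metis DiffD1 rangeE)
  have "w (glue x x y) = i" "w (glue y z y) = j"
    using i[of x x x y] j[of y y y z] xyz by (simp_all add: diag)
  moreover have "w (glue x z z) = k"
    using Z[of z z z x] xyz k by (simp add: diag)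
  \<comment> \<open>A third winner would survive replacing the first argument by \<open>y\<close>,
    but \<open>j\<close> wins at \<open>glue y z y\<close>.\<close>
  moreover have "w (glue x z y) \<in> {i, j}"
    using Z[of x z y y] calculation(2) by force
  \<comment> \<open>If \<open>i\<close> wins at \<open>glue x z y\<close>, it also wins at
    \<open>glue x z z\<close>; if \<open>j\<close> does, it also wins at \<open>glue x x y\<close>.
    Both have a different winner.\<close>
  ultimately show False
    using i[of x z y z] j[of x z y x] ij k by auto
qed

text \<open>Whether \<open>c\<close> loses depends only on the inputs in \<open>W c\<close>, and
  \<open>c\<close> loses exactly when one of the other four wins. The cyclic cover lemma then makes
  \<open>c\<close> lose always.\<close>

lemma no_bowtie:
  assumes I: "I = {c, p, q, r, s}" and dist: "distinct [c, p, q, r, s]"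
    and pq: "W c \<inter> W p \<inter> W q = {}" and rs: "W c \<inter> W r \<inter> W s = {}"
  shows False
proof -
  \<comment> \<open>The inputs read by \<open>c\<close> are split into four blocks such that \<open>p\<close>, \<open>s\<close>, \<open>q\<close>, \<open>r\<close> read
    only the cyclically consecutive blocks \<open>x y\<close>, \<open>y z\<close>, \<open>z t\<close>, \<open>t x\<close>, respectively.\<close>
  define glue where "glue u x y z t = (\<lambda>m. if m \<in> W c
      then if m \<in> W q then if m \<in> W s then z m else t m else if m \<in> W s then y m else x m
      else u m)"
    for u x y z t :: "'j \<Rightarrow> 'b"
  have diag: "glue x x x x x = x" for x
    by (auto simp: glue_def)
  have p: "w (glue u x y z t) = p \<Longrightarrow> w (glue u x y z' t') = p" for u x y z t z' t'
    by (rule window[of p "glue u x y z t"]) (use I pq in \<open>auto simp: glue_def\<close>)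
  have q: "w (glue u x y z t) = q \<Longrightarrow> w (glue u x' y' z t) = q" for u x y z t x' y'
    by (rule window[of q "glue u x y z t"]) (use I in \<open>auto simp: glue_def\<close>)
  have r: "w (glue u x y z t) = r \<Longrightarrow> w (glue u x y' z' t) = r" for u x y z t z' y'
    by (rule window[of r "glue u x y z t"]) (use I rs in \<open>auto simp: glue_def\<close>)
  have s: "w (glue u x y z t) = s \<Longrightarrow> w (glue u x' y z t') = s" for u x y z t x' t'
    by (rule window[of s "glue u x y z t"]) (use I in \<open>auto simp: glue_def\<close>)
  have c: "w (glue u x y z t) = c \<Longrightarrow> w (glue u' x y z t) = c" for u u' x y z t
    by (rule window[of c "glue u x y z t"]) (use I in \<open>auto simp: glue_def\<close>)
  have attained: "\<exists>x. w (glue x x x x x) = i" if "i \<in> I" for i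
    using that range_w unfolding diag by (metis rangeE)
  obtain xp xq xr xs xc where at: "w (glue xp xp xp xp xp) = p" "w (glue xq xq xq xq xq) = q"
    "w (glue xr xr xr xr xr) = r" "w (glue xs xs xs xs xs) = s" "w (glue xc xc xc xc xc) = c"
    using attained I by (metis insertCI)
  \<comment> \<open>Unread arguments are filled with \<open>xc\<close>; the primed facts below show
    that any filler gives the same value.\<close>
  define Z where "Z x y z t \<longleftrightarrow> w (glue xc x y z t) \<noteq> c" for x y z t
  define P where "P u x y \<longleftrightarrow> w (glue u x y xc xc) = p" for u x y
  define S where "S u y z \<longleftrightarrow> w (glue u xc y z xc) = s" for u y z
  define Q where "Q u z t \<longleftrightarrow> w (glue u xc xc z t) = q" for u z t
  define R where "R u t x \<longleftrightarrow> w (glue u x xc xc t) = r" for u t x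
  have P': "P u x y \<longleftrightarrow> w (glue u x y z t) = p" and Q': "Q u z t \<longleftrightarrow> w (glue u x y z t) = q"
    and R': "R u t x \<longleftrightarrow> w (glue u x y z t) = r" and S': "S u y z \<longleftrightarrow> w (glue u x y z t) = s"
    for u x y z t
    unfolding P_def Q_def R_def S_def using p q r s by blast+
  have Z': "Z x y z t \<longleftrightarrow> w (glue u x y z t) \<noteq> c" for u x y z t
    unfolding Z_def using c by blast
  have "Z xc xc xc xc"
  proof (rule cyclic_cover_constant[where f = P and g = S and h = Q and k = R and Z = Z])
    show "Z x y z t \<longleftrightarrow> P u x y \<or> S u y z \<or> Q u z t \<or> R u t x" for u x y z t
      unfolding P'[of u x y z t] Q'[of u z t x y] R'[of u t x y z] S'[of u y z x t] Z'[of x y z t u]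
      using w_in[of "glue u x y z t"] I dist by auto
    show "\<not> (P u x y \<and> Q u z t)" for u x y z t
      unfolding P'[of u x y z t] Q'[of u z t x y] using dist by auto
    show "\<not> (S u y z \<and> R u t x)" for u x y z t
      unfolding S'[of u y z x t] R'[of u t x y z] using dist by auto
    show "\<not> (P u x y \<and> R u t x)" for u x y t
      unfolding P'[of u x y xc t] R'[of u t x y xc] using dist by auto
    show "\<not> (P u x y \<and> S u y z)" for u x y z
      unfolding P'[of u x y z xc] S'[of u y z x xc] using dist by auto
    show "P xp xp xp" "S xs xs xs" "Q xq xq xq" "R xr xr xr"
      using at P' Q' R' S' by blast+
  qed
  then show False
    using at by (simp add: Z_def)
qed

text \<open>Among at most five vertices two different missing triples share a vertex. Sharing only
  one is excluded by \<open>no_bowtie\<close>, so they share a pair. Any missing triple through a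
  vertex outside both contains that same pair, and \<open>no_disconnected_pair\<close> applies to
  it.\<close>

lemma missing_triples_not_covering:
  assumes I: "finite I" "card I \<le> 5" "I \<noteq> {}"
    and cover: "\<And>a. a \<in> I \<Longrightarrow> \<exists>T. a \<in> T \<and> T \<subseteq> I \<and> card T = 3 \<and> (\<Inter>i\<in>T. W i) = {}"
  shows False
proof -
  define N where "N = {T. T \<subseteq> I \<and> card T = 3 \<and> (\<Inter>i\<in>T. W i) = {}}"
  have cover': "\<exists>T\<in>N. a \<in> T" if "a \<in> I" for a
    using cover[OF that] by (auto simp: N_def)
  have N: "T \<subseteq> I" "card T = 3" "finite T" "(\<Inter>i\<in>T. W i) = {}" if "T \<in> N" for T
    using that I(1) finite_subset by (auto simp: N_def)
  have meet: "card (S \<inter> T) = 2" if S: "S \<in> N" and T: "T \<in> N" and ne: "d \<in> T" "d \<notin> S" for S T d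
  proof (rule ccontr)
    assume "card (S \<inter> T) \<noteq> 2"
    have "card (S \<union> T) \<le> 5"
      using card_mono[of I "S \<union> T"] I N[OF S] N[OF T] by auto
    moreover have "card (S \<union> T) + card (S \<inter> T) = 6"
      using card_Un_Int[of S T] N[OF S] N[OF T] by simp
    moreover have "card (S \<inter> T) < card T"
      using ne N[OF T] by (intro psubset_card_mono) auto
    ultimately have one: "card (S \<inter> T) = 1" and five: "card (S \<union> T) = 5"
      using N[OF T] \<open>card (S \<inter> T) \<noteq> 2\<close> by auto
    then obtain c where c: "S \<inter> T = {c}"
      by (auto simp: card_1_singleton_iff)
    then have "c \<in> S" "c \<in> T" by blast+
    then have "card (S - {c}) = 2" "card (T - {c}) = 2"
      using N(2)[OF S] N(2)[OF T] by (simp_all add: card_Diff_singleton)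
    then obtain p q r s where pq: "S - {c} = {p, q}" "p \<noteq> q" and rs: "T - {c} = {r, s}" "r \<noteq> s"
      by (auto simp: card_2_iff)
    have S': "S = {c, p, q}" and T': "T = {c, r, s}"
      using c pq rs by blast+
    have "S \<union> T = I"
      using five I N[OF S] N[OF T] by (intro card_seteq) auto
    then have "I = {c, p, q, r, s}"
      using S' T' by auto
    moreover have "distinct [c, p, q, r, s]"
      using c pq rs by auto
    ultimately show False
      by (rule no_bowtie) (use N(4)[OF S] N(4)[OF T] S' T' in auto)
  qed
  have pair: False if "i \<noteq> j" "k \<in> I - {i, j}" "i \<in> I" "j \<in> I"
    "\<And>l. l \<in> I - {i, j} \<Longrightarrow> {i, j, l} \<in> N" for i j k
  proof (rule no_disconnected_pair)
    show "W i \<inter> W j \<inter> W l = {}" if "l \<in> I - {i, j}" for l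
      using N(4)[of "{i, j, l}"] that \<open>\<And>l. l \<in> I - {i, j} \<Longrightarrow> {i, j, l} \<in> N\<close> by auto
  qed (use that in auto)
  obtain S where S: "S \<in> N"
    using cover' I(3) by blast
  show False
  proof (cases "S = I")
    case True
    \<comment> \<open>With three vertices, \<open>S\<close> is the only triple over any of its
      pairs.\<close>
    obtain i j k where "S = {i, j, k}" "i \<noteq> j" "j \<noteq> k" "i \<noteq> k"
      using N(2)[OF S] by (auto simp: card_3_iff)
    then show False
      using True S by (intro pair[of i j k]) auto
  next
    case False
    then obtain d T where d: "d \<in> I" "d \<notin> S" and T: "T \<in> N" "d \<in> T"
      using cover' N(1)[OF S] by blast
    then obtain i j where ij: "S \<inter> T = {i, j}" "i \<noteq> j"
      using meet[OF S] by (meson card_2_iff)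
    have triple: "U = {i, j, l}" if "U \<in> N" "l \<in> U" "{i, j} \<subseteq> U" "l \<notin> {i, j}" for U l
      using that N[OF that(1)] ij(2) by (intro sym[OF card_seteq]) auto
    have "{i, j, l} \<in> N" if l: "l \<in> I - {i, j}" for l
    proof -
      obtain U where U: "U \<in> N" "l \<in> U" "{i, j} \<subseteq> U"
      proof (cases "l \<in> S \<union> T")
        case True
        then show ?thesis using that S T ij by blast
      next
        case False
        obtain U where U: "U \<in> N" "l \<in> U"
          using cover' l by blast
        have fin: "finite (U - {l})" and two: "card (U - {l}) = 2"
          using N[OF U(1)] U(2) by auto
        \<comment> \<open>As \<open>l\<close> lies outside \<open>S\<close> and \<open>T\<close>,
          the two points that \<open>U\<close> shares with each of them are those of
          \<open>U - {l}\<close>.\<close>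
        have "S \<inter> U = U - {l}"
          using meet[OF S U] False two by (intro card_seteq[OF fin]) auto
        moreover have "T \<inter> U = U - {l}"
          using meet[OF T(1) U] False two by (intro card_seteq[OF fin]) auto
        ultimately have "U - {l} \<subseteq> {i, j}"
          using ij by blast
        then have "U - {l} = {i, j}"
          using two ij by (intro card_seteq) auto
        then show ?thesis using that U by blast
      qed
      then show ?thesis
        using triple[OF U] l by auto
    qed
    then show False
      using pair[of i j d] ij d N(1)[OF S] by blast
  qed
qed

end

section \<open>From a generating complex to a winner\<close>

definition hot :: "nat \<Rightarrow> nat \<Rightarrow> nat \<Rightarrow> nat" where
  "hot n i = (\<lambda>k\<in>index_set n. if k = i then 1 else 0)"

lemma hot_eq_1_iff: "k \<in> index_set n \<Longrightarrow> hot n i k = 1 \<longleftrightarrow> k = i"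
  by (simp add: hot_def)

lemma unique_one_eq: "unique_one n = hot n ` index_set n"
proof (intro equalityI subsetI)
  fix x assume "x \<in> unique_one n"
  then obtain i where x: "x \<in> index_set n \<rightarrow>\<^sub>E {0, 1}" and i: "i \<in> index_set n" "x i = 1"
    and uniq: "\<And>k. k \<in> index_set n \<Longrightarrow> x k = 1 \<Longrightarrow> k = i"
    unfolding unique_one_def by blast
  have "x = hot n i"
  proof
    show "x k = hot n i k" for k
    proof (cases "k \<in> index_set n")
      case True
      then have "x k = 0 \<or> x k = 1"
        using PiE_mem[OF x] by blast
      moreover have "x k = 1 \<longleftrightarrow> k = i"
        using uniq[of k] i True by blast
      ultimately show ?thesis
        using True by (cases "k = i") (simp_all add: hot_def)
    next
      case False
      then show ?thesis
        using PiE_arb[OF x] by (simp add: hot_def)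
    qed
  qed
  with i show "x \<in> hot n ` index_set n" by blast
next
  fix x assume "x \<in> hot n ` index_set n"
  then obtain i where i: "i \<in> index_set n" "x = hot n i" by blast
  have "hot n i \<in> index_set n \<rightarrow>\<^sub>E {0, 1}"
    by (simp add: hot_def)
  moreover have "\<exists>!k. k \<in> index_set n \<and> hot n i k = 1"
    using i(1) by (intro ex1I[of _ i]) (auto simp: hot_def split: if_splits)
  ultimately show "x \<in> unique_one n"
    using i(2) by (simp add: unique_one_def)
qed

text \<open>If every star complex has a simplex outside \<open>K\<close>, then, \<open>K\<close>
  being closed under subsets, every \<open>a\<close> lies in a star triangle outside
  \<open>K\<close>. Its windows have no common input, so these triangles form a cover excluded by
  \<open>missing_triples_not_covering\<close>.\<close>

lemma generates_imp_star_subset: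
  assumes n: "3 \<le> n" "n \<le> 5" and gen: "generates (index_set n) {0, 1} K (unique_one n)"
  shows "\<exists>a\<in>index_set n. star_complex n a \<subseteq> K"
proof (rule ccontr)
  assume no: "\<not> ?thesis"
  let ?I = "index_set n"
  obtain B J :: "nat set" and f where K: "simplicial_complex ?I K" and fin: "finite J"
    and im: "f ` (J \<rightarrow>\<^sub>E B) = unique_one n" and comm: "communication_complex J B ?I f \<subseteq> K"
    using gen unfolding generates_def by blast
  define W where "W = input_window J B f"
  have det: "determines J B f i (W i)" for i
    by (simp add: W_def input_window_least[OF fin])
  have "0 \<in> ?I" using n by (simp add: index_set_def)
  then obtain z where z: "z \<in> J \<rightarrow>\<^sub>E B"
    using im unfolding unique_one_eq by blast
  \<comment> \<open>A retraction onto \<open>J \<rightarrow>\<^sub>E B\<close> acting coordinatewise, so that it preserves agreement on windows.\<close>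
  define ret where "ret x = (\<lambda>j\<in>J. if x j \<in> B then x j else z j)" for x
  have ret_in: "ret x \<in> J \<rightarrow>\<^sub>E B" for x
    using z by (auto simp: ret_def)
  have ret_id: "ret x = x" if "x \<in> J \<rightarrow>\<^sub>E B" for x
    using that by (auto simp: ret_def PiE_iff extensional_def fun_eq_iff)
  have "\<exists>i\<in>?I. f (ret x) = hot n i" for x
    using im ret_in[of x] unfolding unique_one_eq by blast
  then obtain w where w: "\<And>x. w x \<in> ?I" "\<And>x. f (ret x) = hot n (w x)"
    by metis
  have w_iff: "w x = i \<longleftrightarrow> f (ret x) i = 1" if "i \<in> ?I" for x i
    using hot_eq_1_iff[OF that] w by auto
  interpret winner ?I W w
  proof
    have "i \<in> range w" if i: "i \<in> ?I" for i
    proof -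
      obtain x where "x \<in> J \<rightarrow>\<^sub>E B" "f x = hot n i"
        using im i unfolding unique_one_eq by (metis imageE imageI)
      then have "w x = i"
        using w_iff[OF i] ret_id hot_eq_1_iff[OF i] by simp
      then show ?thesis by blast
    qed
    then show "range w = ?I" using w by blast
  next
    fix i x y assume i: "i \<in> ?I" and eq: "\<And>j. j \<in> W i \<Longrightarrow> x j = y j" and "w x = i"
    have "restrict (ret x) (W i) = restrict (ret y) (W i)"
      using eq by (auto simp: ret_def restrict_def)
    then have "f (ret x) i = f (ret y) i"
      using det[of i] ret_in unfolding determines_def by blast
    then show "w y = i" using \<open>w x = i\<close> i by (simp add: w_iff)
  qed
  show False
  proof (rule missing_triples_not_covering)
    show "finite ?I" "card ?I \<le> 5" "?I \<noteq> {}" using n by (auto simp: index_set_def)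
    fix a assume a: "a \<in> ?I"
    then obtain S where S: "S \<in> star_complex n a" "S \<notin> K"
      using no by blast
    then obtain T where T: "T \<in> star_triangles n a" "S \<subseteq> T"
      by (auto simp: star_complex_def)
    have "T \<notin> K"
      using S T K unfolding simplicial_complex_def by blast
    moreover have T': "T \<subseteq> ?I" "a \<in> T" "card T = 3"
      using T(1) a by (auto simp: star_triangles_def)
    ultimately have "(\<Inter>i\<in>T. W i) = {}"
      using comm unfolding communication_complex_def W_def by blast
    then show "\<exists>T. a \<in> T \<and> T \<subseteq> ?I \<and> card T = 3 \<and> (\<Inter>i\<in>T. W i) = {}"
      using T' by blast
  qed
qed

section \<open>Generating by voting\<close>

lemma star_complex_generates:
  assumes n: "3 \<le> n" and a: "a \<in> index_set n"
  shows "generates (index_set n) {0, 1} (star_complex n a) (unique_one n)"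
proof -
  let ?I = "index_set n"
  define E where "E = {T. T \<subseteq> ?I - {a} \<and> card T = 2}"
  \<comment> \<open>Pairs serve as inputs through their codes, since \<open>generates\<close>
    indexes inputs by natural numbers.\<close>
  define J where "J = set_encode ` E"
  define wins where "wins x b \<longleftrightarrow> b \<in> ?I - {a} \<and> (\<forall>T\<in>E. b \<in> T \<longrightarrow> x (set_encode T) = b)"
    for x :: "nat \<Rightarrow> nat" and b
  define w where "w x = (if \<exists>b. wins x b then THE b. wins x b else a)" for x
  define f where "f x = hot n (w x)" for x
  have finI: "finite ?I" by (simp add: index_set_def)
  have finE: "finite E"
    using finI by (auto simp: E_def intro: finite_subset[of _ "Pow ?I"])
  have finT: "finite T" if "T \<in> E" for T
    using that by (auto simp: E_def intro: card_ge_0_finite)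
  have star: "simplicial_complex ?I (star_complex n a)"
    using star_complex_iff[OF n a] by blast
  \<comment> \<open>A candidate without voters would win vacuously, and \<open>a\<close> could never
    win; \<open>3 \<le> n\<close> prevents this.\<close>
  have edge: "\<exists>T\<in>E. b \<in> T" if "b \<in> ?I - {a}" for b
  proof -
    have "card (?I - {a, b}) > 0"
      using n a that by (simp add: index_set_def)
    then obtain c where "c \<in> ?I - {a, b}"
      by (metis all_not_in_conv card.empty less_irrefl)
    then show ?thesis
      using that by (intro bexI[of _ "{b, c}"]) (auto simp: E_def)
  qed
  have uniq: "b = c" if "wins x b" "wins x c" for x b c
  proof (rule ccontr)
    assume "b \<noteq> c"
    then have "{b, c} \<in> E" using that by (auto simp: E_def wins_def)
    then have "x (set_encode {b, c}) = b" "x (set_encode {b, c}) = c"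
      using that unfolding wins_def by blast+
    then show False using \<open>b \<noteq> c\<close> by simp
  qed
  have w_wins: "w x = b" if "wins x b" for x b
  proof -
    have "(THE b. wins x b) = b"
      using that uniq by (intro the_equality)
    then show ?thesis unfolding w_def using that by presburger
  qed
  have w_cases: "wins x (w x) \<or> w x = a" for x
  proof (cases "\<exists>b. wins x b")
    case True
    then show ?thesis using w_wins by blast
  next
    case False
    then show ?thesis by (simp add: w_def)
  qed
  have w_in: "w x \<in> ?I" for x
    using w_cases[of x] a by (auto simp: wins_def)
  have w_iff: "w x = b \<longleftrightarrow> wins x b" if "b \<noteq> a" for x b
    using w_cases[of x] w_wins that by auto
  have f_in: "f \<in> (J \<rightarrow>\<^sub>E ?I) \<rightarrow> (?I \<rightarrow>\<^sub>E {0, 1})"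
    by (auto simp: f_def hot_def)
  have attained: "\<exists>x\<in>J \<rightarrow>\<^sub>E ?I. w x = i" if i: "i \<in> ?I" for i
  proof
    \<comment> \<open>A unanimous vote elects \<open>i\<close>; if \<open>i = a\<close>, no other
      candidate gets a vote.\<close>
    define x where "x = (\<lambda>j\<in>J. i)"
    show "x \<in> J \<rightarrow>\<^sub>E ?I" using i by (simp add: x_def)
    have x: "x (set_encode T) = i" if "T \<in> E" for T
      using that by (simp add: x_def J_def)
    show "w x = i"
    proof (cases "i = a")
      case True
      have "\<not> wins x b" for b
        using x True edge[of b] by (auto simp: wins_def)
      then show ?thesis using True w_cases by blast
    next
      case False
      then show ?thesis using i x by (intro w_wins) (simp add: wins_def)
    qed
  qed
  have im: "f ` (J \<rightarrow>\<^sub>E ?I) = unique_one n"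
    unfolding unique_one_eq f_def using w_in attained by blast
  have win: "input_window J ?I f b \<subseteq> set_encode ` {T \<in> E. b \<in> T}" if b: "b \<in> ?I" "b \<noteq> a" for b
  proof (rule input_window_least(3))
    show "finite J" using finE by (simp add: J_def)
    show "set_encode ` {T \<in> E. b \<in> T} \<subseteq> J" by (auto simp: J_def)
    show "determines J ?I f b (set_encode ` {T \<in> E. b \<in> T})"
      unfolding determines_def
    proof (intro ballI impI)
      fix x y :: "nat \<Rightarrow> nat"
      assume eq: "restrict x (set_encode ` {T \<in> E. b \<in> T}) = restrict y (set_encode ` {T \<in> E. b \<in> T})"
      have "x (set_encode T) = y (set_encode T)" if "T \<in> E" "b \<in> T" for T
        using fun_cong[OF eq, of "set_encode T"] that by simp
      then have "wins x b = wins y b" by (auto simp: wins_def)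
      then have "w x = b \<longleftrightarrow> w y = b" using b w_iff by blast
      then show "f x b = f y b" by (auto simp: f_def hot_def)
    qed
  qed
  \<comment> \<open>An input read by some \<open>b\<close> other than \<open>a\<close> is the code
    of a pair \<open>T\<close>, and all its readers except possibly \<open>a\<close> lie in
    \<open>T\<close>.\<close>
  have "communication_complex J ?I ?I f \<subseteq> star_complex n a"
  proof
    fix S assume "S \<in> communication_complex J ?I ?I f"
    then have SI: "S \<subseteq> ?I" and S: "S \<noteq> {} \<Longrightarrow> (\<Inter>i\<in>S. input_window J ?I f i) \<noteq> {}"
      by (auto simp: communication_complex_def)
    obtain T where T: "T \<in> E" "S \<subseteq> insert a T"
    proof (cases "S \<subseteq> {a}")
      case True
      have "card (?I - {a}) \<noteq> 0" using n a by (simp add: index_set_def)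
      then obtain b where "b \<in> ?I - {a}" by (metis all_not_in_conv card.empty)
      then show ?thesis using edge that True by blast
    next
      case False
      then obtain b j where b: "b \<in> S" "b \<noteq> a" and j: "\<And>i. i \<in> S \<Longrightarrow> j \<in> input_window J ?I f i"
        using S by blast
      obtain T where T: "T \<in> E" "j = set_encode T"
        using win[of b] j[of b] b SI by blast
      have "c \<in> T" if c: "c \<in> S" "c \<noteq> a" for c
      proof -
        obtain T' where "T' \<in> E" "c \<in> T'" "j = set_encode T'"
          using win[of c] j[of c] c SI by blast
        then show ?thesis
          using T finT set_encode_eq[of T T'] by simp
      qed
      then show ?thesis using that T by blast
    qed
    obtain b c where "T = {b, c}" "b \<noteq> c"
      using T(1) by (auto simp: E_def card_2_iff)
    then have "insert a T \<in> star_triangles n a"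
      using T(1) by (auto simp: E_def star_triangles_def)
    then show "S \<in> star_complex n a"
      using T(2) by (auto simp: star_complex_def)
  qed
  moreover have "finite J" using finE by (simp add: J_def)
  ultimately show ?thesis
    unfolding generates_def using star f_in im finI by blast
qed

section \<open>Comparing star complexes, and minimality\<close>

text \<open>By cardinality, every star triangle of \<open>a\<close> is one of \<open>b\<close> and
  so contains \<open>b\<close>. A triangle \<open>{b, c, d}\<close> avoiding \<open>a\<close> would
  give \<open>{a, c, d}\<close>, which omits \<open>b\<close>. The conclusion is not
  \<open>a = b\<close>, because for \<open>n = 3\<close> all star complexes coincide.\<close>

lemma star_complex_subset_imp_eq:
  assumes a: "a \<in> index_set n" and b: "b \<in> index_set n" and sub: "star_complex n a \<subseteq> star_complex n b"
  shows "star_complex n a = star_complex n b"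
proof -
  have mem: "b \<in> T" if T: "T \<in> star_triangles n a" for T
  proof -
    have "T \<in> star_complex n b"
      using T sub by (auto simp: star_complex_def)
    then obtain U where U: "U \<in> star_triangles n b" "T \<subseteq> U"
      by (auto simp: star_complex_def)
    have "card T = 3" "card U = 3" "finite U" "b \<in> U"
      using T U(1) by (auto simp: star_triangles_def)
    then show ?thesis using U(2) card_subset_eq[of U T] by simp
  qed
  have "T \<in> star_triangles n a" if T: "T \<in> star_triangles n b" for T
  proof -
    obtain c d where cd: "T = {b, c, d}" "c \<in> index_set n - {b}" "d \<in> index_set n - {b}" "c \<noteq> d"
      using T unfolding star_triangles_def by blast
    have "a \<in> T"
    proof (rule ccontr)
      assume "a \<notin> T"
      then have "{a, c, d} \<in> star_triangles n a"
        using cd unfolding star_triangles_def by blast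
      from mem[OF this] show False using cd \<open>a \<notin> T\<close> by blast
    qed
    then consider "a = b" | "a = c" | "a = d" using cd by blast
    then show ?thesis
    proof cases
      case 1
      then show ?thesis using T by simp
    next
      case 2
      then have "T = {a, b, d}" using cd by auto
      then show ?thesis using cd 2 b unfolding star_triangles_def by blast
    next
      case 3
      then have "T = {a, b, c}" using cd by auto
      then show ?thesis using cd 3 b unfolding star_triangles_def by blast
    qed
  qed
  then show ?thesis using sub by (auto simp: star_complex_def)
qed

theorem proposition4p3:
  fixes n :: nat
  assumes "3 \<le> n" and "n \<le> 5"
  shows "{K. minimal_generating (index_set n) {0, 1} K (unique_one n)}
         = {star_complex n a | a. a \<in> index_set n}"
proof (intro equalityI subsetI)
  fix K assume "K \<in> {K. minimal_generating (index_set n) {0, 1} K (unique_one n)}"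
  then have gen: "generates (index_set n) {0, 1} K (unique_one n)"
    and min: "\<And>K'. K' \<subset> K \<Longrightarrow> \<not> generates (index_set n) {0, 1} K' (unique_one n)"
    by (auto simp: minimal_generating_def)
  obtain a where a: "a \<in> index_set n" "star_complex n a \<subseteq> K"
    using generates_imp_star_subset[OF assms gen] by blast
  then have "K = star_complex n a"
    using min star_complex_generates[OF assms(1) a(1)] by blast
  then show "K \<in> {star_complex n a | a. a \<in> index_set n}" using a by blast
next
  fix K assume "K \<in> {star_complex n a | a. a \<in> index_set n}"
  then obtain a where a: "a \<in> index_set n" and K: "K = star_complex n a" by blast
  \<comment> \<open>A generating \<open>K'\<close> contains a star complex, which lies in
    \<open>K\<close> and hence equals \<open>K\<close>, so \<open>K'\<close> is not a proper
    subset.\<close>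
  have "\<not> generates (index_set n) {0, 1} K' (unique_one n)" if "K' \<subset> K" for K'
    using generates_imp_star_subset[OF assms, of K'] star_complex_subset_imp_eq[OF _ a] that K
    by blast
  then show "K \<in> {K. minimal_generating (index_set n) {0, 1} K (unique_one n)}"
    using star_complex_generates[OF assms(1) a] K by (auto simp: minimal_generating_def)
qed

end
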